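(* Let $G_1$ and $G_2$ be graphs on $n$ vertices, with operator systems $\mathcal{S}_{G_1}, \mathcal{S}_{G_2} \subseteq M_n$. The following are equivalent: (1) $G_1$ is isomorphic to $G_2$; (2) there exists a unitary $U \in M_n$ such that $U^*\mathcal{S}_{G_1} U = \mathcal{S}_{G_2}$; (3) $\mathcal{S}_{G_1}$ is unitally, completely order isomorphic to $\mathcal{S}_{G_2}$.
   Context: $M_n$ denotes the complex $n\times n$ matrices, with canonical matrix units $E_{i,j}$. A graph $G$ on $n$ vertices is a subset $G \subseteq \{1,\dots,n\}\times\{1,\dots,n\}$ that is symmetric ($(i,j)\in G \iff (j,i)\in G$) and contains no $(i,i)$. Put $\widetilde{G} = G\cup\{(i,i): 1\le i\le n\}$. The operator system of $G$ is $\mathcal{S}_G = \operatorname{span}\{E_{i,j} : (i,j)\in\widetilde{G}\}\subseteq M_n$. Graphs $G_1,G_2$ on $n$ vertices are isomorphic if there is a permutation $\pi$ of $\{1,\dots,n\}$ with $G_2=\{(\pi(i),\pi(j)) : (i,j)\in G_1\}$. An operator system is a unital $*$-closed subspace $\mathcal{S}$ of $\mathcal{B}(\mathcal{H})$ for a Hilbert space $\mathcal{H}$; $M_k(\mathcal{S})^+$ denotes the set of elements of $M_k(\mathcal{S})\subseteq M_k(\mathcal{B}(\mathcal{H})) = \mathcal{B}(\mathcal{H}\otimes\mathbb{C}^k)$ that are positive operators. A linear map $\phi:\mathcal{S}\to\mathcal{T}$ of operator systems is completely positive if for all $k$, $(X_{i,j})\in M_k(\mathcal{S})^+$ implies $(\phi(X_{i,j}))\in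 M_k(\mathcal{T})^+$; it is unital if $\phi(I)=I$. It is a complete order isomorphism if it is bijective and $\phi$ and $\phi^{-1}$ are both completely positive. *)

theory Defs
  imports "HOL-Analysis.Analysis"
begin

section \<open>Complex matrices\<close>

text \<open>
  \<open>M\<^sub>n\<close> is the type \<^typ>\<open>complex^'n^'n\<close>, with \<open>n = CARD('n)\<close> and the elements of \<open>'n\<close> as the
  index set. The library's scaling and inner product on this type are real, so the complex ones
  are introduced here.
\<close>

definition cmat_scale :: "complex \<Rightarrow> complex^'n^'m \<Rightarrow> complex^'n^'m" where
  "cmat_scale c A = (\<chi> i j. c * A $ i $ j)"

global_interpretation cmat: vector_space "cmat_scale :: complex \<Rightarrow> complex^'n^'m \<Rightarrow> complex^'n^'m"
  by unfold_locales (simp_all add: cmat_scale_def vec_eq_iff algebra_simps)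

definition cmat_adjoint :: "complex^'n^'m \<Rightarrow> complex^'m^'n" where
  "cmat_adjoint A = (\<chi> i j. cnj (A $ j $ i))"

definition unitary_mat :: "complex^'n^'n \<Rightarrow> bool" where
  "unitary_mat U \<longleftrightarrow> cmat_adjoint U ** U = mat 1 \<and> U ** cmat_adjoint U = mat 1"

definition matrix_unit :: "'n \<Rightarrow> 'n \<Rightarrow> complex^'n^'n" where
  "matrix_unit i j = (\<chi> a b. if a = i \<and> b = j then 1 else 0)"

definition cvec_inner :: "complex^'n \<Rightarrow> complex^'n \<Rightarrow> complex" where
  "cvec_inner x y = (\<Sum>a\<in>UNIV. x $ a * cnj (y $ a))"


section \<open>Operator systems in matrix algebras\<close>

definition operator_system :: "(complex^'n^'n) set \<Rightarrow> bool" where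
  "operator_system S \<longleftrightarrow> cmat.subspace S \<and> mat 1 \<in> S \<and> (\<forall>A\<in>S. cmat_adjoint A \<in> S)"

text \<open>
  An element of \<open>M\<^sub>k(M\<^sub>n)\<close> is a function \<open>X\<close> of which only the entries \<open>X i j\<close> with \<open>i, j < k\<close>
  matter. It acts on \<open>\<xi> = (\<xi>\<^sub>0, \<dots>, \<xi>\<^sub>k\<^sub>-\<^sub>1)\<close> in the \<open>k\<close>-fold direct sum of \<open>\<complex>\<^sup>n\<close>, which is
  \<open>\<complex>\<^sup>n \<otimes> \<complex>\<^sup>k\<close>, by \<open>(X \<xi>)\<^sub>i = \<Sum>\<^sub>j X\<^sub>i\<^sub>j \<xi>\<^sub>j\<close>; positivity of this operator says that
  \<open>\<langle>X \<xi>, \<xi>\<rangle>\<close> is a nonnegative real number for every \<open>\<xi>\<close>.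
\<close>

definition positive_block :: "nat \<Rightarrow> (nat \<Rightarrow> nat \<Rightarrow> complex^'n^'n) \<Rightarrow> bool" where
  "positive_block k X \<longleftrightarrow>
     (\<forall>\<xi> :: nat \<Rightarrow> complex^'n.
        (\<Sum>i<k. cvec_inner (\<Sum>j<k. X i j *v \<xi> j) (\<xi> i)) \<in> \<real>\<^sub>\<ge>\<^sub>0)"

definition matrix_cone :: "nat \<Rightarrow> (complex^'n^'n) set \<Rightarrow> (nat \<Rightarrow> nat \<Rightarrow> complex^'n^'n) set" where
  "matrix_cone k S = {X. (\<forall>i<k. \<forall>j<k. X i j \<in> S) \<and> positive_block k X}"

text \<open>Maps between operator systems are total functions, used only on the domain \<open>S\<close>.\<close>

definition clinear_between ::
    "(complex^'n^'n) set \<Rightarrow> (complex^'m^'m) set \<Rightarrow> (complex^'n^'n \<Rightarrow> complex^'m^'m) \<Rightarrow> bool" where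
  "clinear_between S T \<phi> \<longleftrightarrow>
     \<phi> ` S \<subseteq> T \<and>
     (\<forall>A\<in>S. \<forall>B\<in>S. \<phi> (A + B) = \<phi> A + \<phi> B) \<and>
     (\<forall>c. \<forall>A\<in>S. \<phi> (cmat_scale c A) = cmat_scale c (\<phi> A))"

definition completely_positive ::
    "(complex^'n^'n) set \<Rightarrow> (complex^'m^'m) set \<Rightarrow> (complex^'n^'n \<Rightarrow> complex^'m^'m) \<Rightarrow> bool" where
  "completely_positive S T \<phi> \<longleftrightarrow>
     clinear_between S T \<phi> \<and>
     (\<forall>k. \<forall>X\<in>matrix_cone k S. (\<lambda>i j. \<phi> (X i j)) \<in> matrix_cone k T)"

definition complete_order_iso ::
    "(complex^'n^'n) set \<Rightarrow> (complex^'m^'m) set \<Rightarrow> (complex^'n^'n \<Rightarrow> complex^'m^'m) \<Rightarrow> bool" where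
  "complete_order_iso S T \<phi> \<longleftrightarrow>
     bij_betw \<phi> S T \<and> completely_positive S T \<phi> \<and> completely_positive T S (inv_into S \<phi>)"

definition unitally_completely_order_isomorphic ::
    "(complex^'n^'n) set \<Rightarrow> (complex^'m^'m) set \<Rightarrow> bool" where
  "unitally_completely_order_isomorphic S T \<longleftrightarrow>
     (\<exists>\<phi>. complete_order_iso S T \<phi> \<and> \<phi> (mat 1) = mat 1)"


section \<open>Graphs and their operator systems\<close>

definition is_graph :: "('n \<times> 'n) set \<Rightarrow> bool" where
  "is_graph G \<longleftrightarrow> sym G \<and> irrefl G"

definition graph_isomorphic :: "('n \<times> 'n) set \<Rightarrow> ('n \<times> 'n) set \<Rightarrow> bool" where
  "graph_isomorphic G1 G2 \<longleftrightarrow> (\<exists>\<pi>. bij \<pi> \<and> G2 = {(\<pi> i, \<pi> j) | i j. (i, j) \<in> G1})"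

definition graph_system :: "('n \<times> 'n) set \<Rightarrow> (complex^'n^'n) set" where
  "graph_system G = cmat.span {matrix_unit i j | i j. (i, j) \<in> G \<union> Id}"

lemma operator_system_graph_system:
  fixes G :: "('n::finite \<times> 'n) set"
  assumes "is_graph G"
  shows "operator_system (graph_system G)"
proof -
  let ?B = "{matrix_unit i j | i j. (i, j) \<in> G \<union> Id}"
  have "(\<Sum>i\<in>UNIV. matrix_unit i i) \<in> graph_system G"
    unfolding graph_system_def by (intro cmat.span_sum cmat.span_base) auto
  moreover have "(\<Sum>i\<in>UNIV. matrix_unit i i) = (mat 1 :: complex^'n^'n)"
    by (simp add: vec_eq_iff matrix_unit_def mat_def if_distrib sum.delta' sum.delta flip: of_bool_def)
  moreover have "cmat_adjoint A \<in> graph_system G" if "A \<in> graph_system G" for A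
    using that unfolding graph_system_def
  proof (induction rule: cmat.span_induct_alt)
    case base
    have "cmat_adjoint 0 = (0 :: complex^'n^'n)"
      by (simp add: cmat_adjoint_def vec_eq_iff)
    then show ?case by (simp add: cmat.span_zero)
  next
    case (step c x y)
    then obtain i j where x: "x = matrix_unit i j" and ij: "(i, j) \<in> G \<union> Id" by blast
    have "cmat_adjoint (cmat_scale c x + y) = cmat_scale (cnj c) (matrix_unit j i) + cmat_adjoint y"
      by (auto simp: x cmat_adjoint_def cmat_scale_def matrix_unit_def vec_eq_iff)
    moreover have "(j, i) \<in> G \<union> Id"
      using ij assms by (auto simp: is_graph_def sym_def)
    then have "matrix_unit j i \<in> cmat.span ?B"
      by (intro cmat.span_base) blast
    ultimately show ?case
      using step by (simp add: cmat.span_add cmat.span_scale)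
  qed
  ultimately show ?thesis
    by (simp add: operator_system_def graph_system_def)
qed

end

theory Submission
  imports Defs
begin

text \<open>
  A permutation matrix conjugates one graph system to the other when the graphs are isomorphic,
  and conjugation by a unitary is a unital complete order isomorphism. The substance is the way
  back from a unital complete order isomorphism \<open>\<phi>\<close>, with inverse \<open>\<psi>\<close>, to an isomorphism of
  graphs.

  Both maps have Kraus forms, \<open>\<phi>(A) = \<Sum>\<^sub>k V\<^sub>k\<^sup>* A V\<^sub>k\<close> on the first system and
  \<open>\<psi>(B) = \<Sum>\<^sub>l W\<^sub>l\<^sup>* B W\<^sub>l\<close> on the second (\<open>completely_positive_kraus_form\<close>). This is proved by
  convexity: if \<open>\<phi>\<close> were not, up to scaling, a convex combination of the maps \<open>A \<mapsto> V\<^sup>* A V\<close>, then a separating functional, read as an element of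
  \<open>M\<^sub>n(S)\<close>, would after a shift be a positive element whose image is not positive.

  Since \<open>\<psi> \<circ> \<phi>\<close> fixes all \<open>E\<^sub>i\<^sub>j\<close> with \<open>i = j\<close> or \<open>(i, j)\<close> an edge, the products \<open>V\<^sub>k W\<^sub>l\<close> are
  diagonal, and their diagonals are constant along edges. For generic linear combinations
  \<open>Z = \<Sum>\<^sub>k t\<^sub>k V\<^sub>k\<close> and \<open>Y = \<Sum>\<^sub>l s\<^sub>l W\<^sub>l\<close> the diagonal matrix \<open>Z Y\<close> is invertible, whence
  \<open>V\<^sub>k = V\<^sub>k Y (Z Y)\<^sup>-\<^sup>1 Z = D\<^sub>k Z\<close> for diagonal matrices \<open>D\<^sub>k\<close> that are again constant along edges
  (\<open>diagonal_products_factorization\<close>). So for an edge \<open>(i, j)\<close> the \<open>(a, b)\<close> entry of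
  \<open>\<phi>(E\<^sub>i\<^sub>j)\<close> is a positive multiple of \<open>cnj Z\<^sub>i\<^sub>a Z\<^sub>j\<^sub>b\<close>. As \<open>det Z \<noteq> 0\<close>, some permutation \<open>\<pi>\<close> has
  \<open>Z\<^sub>i\<^sub>,\<^sub>\<pi>\<^sub>(\<^sub>i\<^sub>) \<noteq> 0\<close> for all \<open>i\<close>, and then \<open>\<phi>(E\<^sub>i\<^sub>j)\<close> has a nonzero entry at \<open>(\<pi>(i), \<pi>(j))\<close>, which
  must be an edge of the second graph. Exchanging \<open>\<phi>\<close> and \<open>\<psi>\<close> embeds the second graph in the first
  as well, so both have equally many edges and \<open>\<pi>\<close> is an isomorphism.
\<close>

section \<open>Graph systems as spaces of matrices with prescribed zeros\<close>

lemma matrix_unit_nth [simp]: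
  "matrix_unit i j $ a $ b = (if a = i \<and> b = j then 1 else 0)"
  by (simp add: matrix_unit_def)

text \<open>
  The index set \<open>E\<close> is not tied to the support of \<open>A\<close>, so that all of a graph system can be expanded
  over one set of matrix units.
\<close>

lemma matrix_expansion:
  fixes A :: "complex^'n::finite^'n"
  assumes "\<And>i j. (i, j) \<notin> E \<Longrightarrow> A $ i $ j = 0"
  shows "A = (\<Sum>p\<in>E. cmat_scale (A $ fst p $ snd p) (matrix_unit (fst p) (snd p)))"
proof -
  have "(\<Sum>p\<in>E. A $ fst p $ snd p * (if a = fst p \<and> b = snd p then 1 else 0)) = A $ a $ b" for a b
  proof -
    have "(\<Sum>p\<in>E. A $ fst p $ snd p * (if a = fst p \<and> b = snd p then 1 else 0))
        = (\<Sum>p\<in>E. if p = (a, b) then A $ a $ b else 0)"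
      by (rule sum.cong) auto
    then show ?thesis using assms by auto
  qed
  then show ?thesis by (simp add: vec_eq_iff cmat_scale_def)
qed

lemma mem_graph_system_iff:
  fixes G :: "('n::finite \<times> 'n) set"
  shows "A \<in> graph_system G \<longleftrightarrow> (\<forall>i j. (i, j) \<notin> G \<union> Id \<longrightarrow> A $ i $ j = 0)"
proof
  assume "A \<in> graph_system G"
  then show "\<forall>i j. (i, j) \<notin> G \<union> Id \<longrightarrow> A $ i $ j = 0"
    unfolding graph_system_def
  proof (induction rule: cmat.span_induct_alt)
    case (step c x y)
    then show ?case by (auto simp: cmat_scale_def split: if_splits)
  qed simp
next
  assume "\<forall>i j. (i, j) \<notin> G \<union> Id \<longrightarrow> A $ i $ j = 0"
  then have "A = (\<Sum>p\<in>G \<union> Id. cmat_scale (A $ fst p $ snd p) (matrix_unit (fst p) (snd p)))"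
    by (intro matrix_expansion) auto
  also have "\<dots> \<in> graph_system G"
    unfolding graph_system_def
    by (intro cmat.span_sum cmat.span_scale cmat.span_base) force
  finally show "A \<in> graph_system G" .
qed

lemma matrix_unit_mem_graph_system:
  fixes G :: "('n::finite \<times> 'n) set"
  assumes "(i, j) \<in> G \<union> Id"
  shows "matrix_unit i j \<in> graph_system G"
  using assms by (auto simp: mem_graph_system_iff)

lemma clinear_between_sum:
  assumes lin: "clinear_between S T \<phi>" and sub: "cmat.subspace S"
    and "finite F" and "\<And>x. x \<in> F \<Longrightarrow> f x \<in> S"
  shows "\<phi> (\<Sum>x\<in>F. f x) = (\<Sum>x\<in>F. \<phi> (f x))"
  using assms(3,4)
proof (induction F rule: finite_induct)
  case empty
  have "\<phi> (cmat_scale 0 0) = cmat_scale 0 (\<phi> 0)"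
    using lin cmat.subspace_0[OF sub] unfolding clinear_between_def by blast
  then show ?case by simp
next
  case (insert x F)
  have "(\<Sum>x\<in>F. f x) \<in> S"
    using insert by (intro cmat.subspace_sum[OF sub]) auto
  then have "\<phi> (f x + (\<Sum>x\<in>F. f x)) = \<phi> (f x) + \<phi> (\<Sum>x\<in>F. f x)"
    using lin insert unfolding clinear_between_def by blast
  then show ?case using insert by simp
qed

lemma clinear_between_graph_system_expansion:
  fixes G :: "('n::finite \<times> 'n) set" and \<phi> :: "complex^'n^'n \<Rightarrow> complex^'m^'m"
  assumes lin: "clinear_between (graph_system G) T \<phi>" and A: "A \<in> graph_system G"
  shows "\<phi> A = (\<Sum>p\<in>G \<union> Id. cmat_scale (A $ fst p $ snd p) (\<phi> (matrix_unit (fst p) (snd p))))"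
proof -
  have sub: "cmat.subspace (graph_system G)"
    unfolding graph_system_def by (rule cmat.subspace_span)
  have mu: "matrix_unit (fst p) (snd p) \<in> graph_system G" if "p \<in> G \<union> Id" for p
    using that by (intro matrix_unit_mem_graph_system) auto
  have "\<phi> A = \<phi> (\<Sum>p\<in>G \<union> Id. cmat_scale (A $ fst p $ snd p) (matrix_unit (fst p) (snd p)))"
    using A by (subst matrix_expansion[of "G \<union> Id" A]) (auto simp: mem_graph_system_iff)
  also have "\<dots> = (\<Sum>p\<in>G \<union> Id. \<phi> (cmat_scale (A $ fst p $ snd p) (matrix_unit (fst p) (snd p))))"
    using mu by (intro clinear_between_sum[OF lin sub] cmat.subspace_scale[OF sub]) auto
  also have "\<dots> = (\<Sum>p\<in>G \<union> Id. cmat_scale (A $ fst p $ snd p) (\<phi> (matrix_unit (fst p) (snd p))))"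
    using lin mu unfolding clinear_between_def by (intro sum.cong) auto
  finally show ?thesis .
qed

section \<open>Congruences are completely positive\<close>

lemma block_form_expand:
  "(\<Sum>i<k. cvec_inner (\<Sum>j<k. X i j *v \<xi> j) (\<xi> i))
   = (\<Sum>i<k. \<Sum>j<k. \<Sum>(a, b)\<in>UNIV. X i j $ a $ b * \<xi> j $ b * cnj (\<xi> i $ a))"
proof -
  have "cvec_inner (\<Sum>j<k. X i j *v \<xi> j) (\<xi> i)
      = (\<Sum>j<k. \<Sum>(a, b)\<in>UNIV. X i j $ a $ b * \<xi> j $ b * cnj (\<xi> i $ a))" for i
  proof -
    have "cvec_inner (\<Sum>j<k. X i j *v \<xi> j) (\<xi> i)
      = (\<Sum>a\<in>UNIV. \<Sum>j<k. \<Sum>b\<in>UNIV. X i j $ a $ b * \<xi> j $ b * cnj (\<xi> i $ a))"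
      by (simp add: cvec_inner_def matrix_vector_mult_def sum_distrib_right)
    also have "\<dots> = (\<Sum>j<k. \<Sum>a\<in>UNIV. \<Sum>b\<in>UNIV. X i j $ a $ b * \<xi> j $ b * cnj (\<xi> i $ a))"
      by (rule sum.swap)
    also have "\<dots> = (\<Sum>j<k. \<Sum>(a, b)\<in>UNIV. X i j $ a $ b * \<xi> j $ b * cnj (\<xi> i $ a))"
      by (simp add: sum.cartesian_product)
    finally show ?thesis .
  qed
  then show ?thesis by simp
qed

lemma cvec_inner_adjoint:
  fixes V :: "complex^'m::finite^'n::finite"
  shows "cvec_inner (cmat_adjoint V *v x) y = cvec_inner x (V *v y)"
proof -
  have "cvec_inner (cmat_adjoint V *v x) y = (\<Sum>a\<in>UNIV. \<Sum>b\<in>UNIV. cnj (V $ b $ a) * x $ b * cnj (y $ a))"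
    by (simp add: cvec_inner_def matrix_vector_mult_def cmat_adjoint_def sum_distrib_right)
  also have "\<dots> = (\<Sum>b\<in>UNIV. \<Sum>a\<in>UNIV. cnj (V $ b $ a) * x $ b * cnj (y $ a))"
    by (rule sum.swap)
  also have "\<dots> = cvec_inner x (V *v y)"
    by (simp add: cvec_inner_def matrix_vector_mult_def sum_distrib_left mult_ac)
  finally show ?thesis .
qed

lemma matrix_vector_mult_sum:
  fixes A :: "complex^'n::finite^'m::finite"
  shows "A *v (\<Sum>j\<in>F. x j) = (\<Sum>j\<in>F. A *v x j)"
  by (induction F rule: infinite_finite_induct) (simp_all add: matrix_vector_right_distrib)

text \<open>
  The block form of \<open>V\<^sup>* X V\<close> at \<open>\<xi>\<close> is the block form of \<open>X\<close> at \<open>V \<xi>\<close>. The map need only agree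
  with the congruence on \<open>S\<close>, which lets the lemma apply to an inverse taken relative to \<open>S\<close>.
\<close>

lemma completely_positive_congruence:
  fixes S :: "(complex^'n::finite^'n) set" and V :: "complex^'m::finite^'n"
  assumes eq: "\<And>A. A \<in> S \<Longrightarrow> \<phi> A = cmat_adjoint V ** A ** V"
    and ran: "\<phi> ` S \<subseteq> T" and sub: "cmat.subspace S"
  shows "completely_positive S T \<phi>"
proof -
  have "cmat_adjoint V ** (A + B) ** V = cmat_adjoint V ** A ** V + cmat_adjoint V ** B ** V" for A B
    by (simp add: vec_eq_iff matrix_matrix_mult_def sum_distrib_right ring_distribs sum.distrib)
  then have add: "\<phi> (A + B) = \<phi> A + \<phi> B" if "A \<in> S" "B \<in> S" for A B
    using that cmat.subspace_add[OF sub that]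
    by (simp add: eq)
  have "cmat_adjoint V ** cmat_scale c A ** V = cmat_scale c (cmat_adjoint V ** A ** V)" for c A
    by (simp add: vec_eq_iff matrix_matrix_mult_def cmat_scale_def sum_distrib_left
        sum_distrib_right mult_ac)
  then have scale: "\<phi> (cmat_scale c A) = cmat_scale c (\<phi> A)" if "A \<in> S" for c A
    using that cmat.subspace_scale[OF sub that] by (simp add: eq)
  have "(\<lambda>i j. \<phi> (X i j)) \<in> matrix_cone k T" if X: "X \<in> matrix_cone k S" for k X
  proof -
    have "(\<Sum>i<k. cvec_inner (\<Sum>j<k. \<phi> (X i j) *v \<xi> j) (\<xi> i))
        = (\<Sum>i<k. cvec_inner (\<Sum>j<k. X i j *v (V *v \<xi> j)) (V *v \<xi> i))" for \<xi>
    proof (rule sum.cong)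
      fix i assume i: "i \<in> {..<k}"
      have "(\<Sum>j<k. \<phi> (X i j) *v \<xi> j) = (\<Sum>j<k. cmat_adjoint V *v (X i j *v (V *v \<xi> j)))"
        using X i by (intro sum.cong) (auto simp: matrix_cone_def eq matrix_vector_mul_assoc matrix_mul_assoc)
      then show "cvec_inner (\<Sum>j<k. \<phi> (X i j) *v \<xi> j) (\<xi> i)
          = cvec_inner (\<Sum>j<k. X i j *v (V *v \<xi> j)) (V *v \<xi> i)"
        by (simp add: cvec_inner_adjoint flip: matrix_vector_mult_sum)
    qed simp
    then show ?thesis
      using X ran by (auto simp: matrix_cone_def positive_block_def)
  qed
  then show ?thesis
    using add scale ran by (auto simp: completely_positive_def clinear_between_def)
qed

lemma cmat_adjoint_mult:
  "cmat_adjoint (A ** B) = cmat_adjoint B ** cmat_adjoint A"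
  by (simp add: vec_eq_iff cmat_adjoint_def matrix_matrix_mult_def mult.commute)

lemma unitarily_conjugate_imp_order_isomorphic:
  fixes U :: "complex^'n::finite^'n"
  assumes U: "unitary_mat U" and T: "{cmat_adjoint U ** A ** U | A. A \<in> S} = T"
    and S: "cmat.subspace S" "cmat.subspace T"
  shows "unitally_completely_order_isomorphic S T"
proof -
  define \<phi> where "\<phi> = (\<lambda>A. cmat_adjoint U ** A ** U)"
  have U1: "cmat_adjoint U ** U = mat 1" and U2: "U ** cmat_adjoint U = mat 1"
    using U by (auto simp: unitary_mat_def)
  have inv: "U ** \<phi> A ** cmat_adjoint U = A" for A
  proof -
    have "U ** \<phi> A ** cmat_adjoint U = (U ** cmat_adjoint U) ** A ** (U ** cmat_adjoint U)"
      by (simp add: \<phi>_def matrix_mul_assoc)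
    then show ?thesis by (simp add: U2)
  qed
  have im: "\<phi> ` S = T" using T by (auto simp: \<phi>_def)
  have inj: "inj_on \<phi> S" by (rule inj_on_inverseI[where g = "\<lambda>B. U ** B ** cmat_adjoint U"]) (rule inv)
  have bij: "bij_betw \<phi> S T" using inj im by (simp add: bij_betw_def)
  have aa: "cmat_adjoint (cmat_adjoint U) = U" by (simp add: cmat_adjoint_def vec_eq_iff)
  have inv_eq: "inv_into S \<phi> B = cmat_adjoint (cmat_adjoint U) ** B ** cmat_adjoint U" if "B \<in> T" for B
    using that im inv inj by (auto simp: aa)
  have "completely_positive S T \<phi>"
    by (rule completely_positive_congruence[where V = U]) (use im S in \<open>auto simp: \<phi>_def\<close>)
  moreover have "completely_positive T S (inv_into S \<phi>)"
    using inv_into_into[of _ \<phi> S] im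
    by (intro completely_positive_congruence[OF inv_eq] S) auto
  moreover have "\<phi> (mat 1) = mat 1" by (simp add: \<phi>_def U1)
  ultimately show ?thesis
    using bij unfolding unitally_completely_order_isomorphic_def complete_order_iso_def by blast
qed

section \<open>Isomorphic graphs have unitarily conjugate systems\<close>

text \<open>
  Conjugation by the permutation matrix of \<open>\<pi>\<close> moves the entry at \<open>(i, j)\<close> to \<open>(\<pi> i, \<pi> j)\<close>, so it
  transports the prescribed zeros of one graph system to those of the other.
\<close>

lemma graph_isomorphic_imp_unitarily_conjugate:
  fixes G1 G2 :: "('n::finite \<times> 'n) set"
  assumes "graph_isomorphic G1 G2"
  shows "\<exists>U :: complex^'n^'n. unitary_mat U \<and>
           {cmat_adjoint U ** A ** U | A. A \<in> graph_system G1} = graph_system G2"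
proof -
  obtain \<pi> where \<pi>: "bij \<pi>" and G2: "G2 = {(\<pi> i, \<pi> j) | i j. (i, j) \<in> G1}"
    using assms by (auto simp: graph_isomorphic_def)
  define \<rho> where "\<rho> = inv \<pi>"
  have \<rho>: "\<rho> (\<pi> i) = i" "\<pi> (\<rho> a) = a" for i a
    using \<pi> by (auto simp: \<rho>_def bij_is_inj bij_is_surj surj_f_inv_f)
  have inj_\<rho>: "inj \<rho>" by (rule inj_on_inverseI[where g = \<pi>]) (rule \<rho>)
  define U :: "complex^'n^'n" where "U = (\<chi> i a. if i = \<rho> a then 1 else 0)"
  have conj: "cmat_adjoint U ** A ** U = (\<chi> a b. A $ \<rho> a $ \<rho> b)" for A
    by (simp add: vec_eq_iff matrix_matrix_mult_def cmat_adjoint_def U_def if_distrib if_distribR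
        sum.delta sum.delta' cong: if_cong)
  have "cmat_adjoint U ** mat 1 ** U = mat 1"
    unfolding conj using inj_\<rho> by (simp add: vec_eq_iff mat_def inj_eq)
  then have "cmat_adjoint U ** U = mat 1" by simp
  moreover from this have "U ** cmat_adjoint U = mat 1"
    using matrix_left_right_inverse by blast
  moreover have mem: "(\<rho> a, \<rho> b) \<in> G1 \<union> Id \<longleftrightarrow> (a, b) \<in> G2 \<union> Id" for a b
  proof -
    have "(a, b) \<in> G2 \<longleftrightarrow> (\<rho> a, \<rho> b) \<in> G1"
    proof
      assume "(\<rho> a, \<rho> b) \<in> G1"
      then have "(\<pi> (\<rho> a), \<pi> (\<rho> b)) \<in> G2" unfolding G2 by blast
      then show "(a, b) \<in> G2" by (simp add: \<rho>)
    qed (auto simp: G2 \<rho>)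
    then show ?thesis using inj_\<rho> by (auto simp: inj_eq)
  qed
  have "{cmat_adjoint U ** A ** U | A. A \<in> graph_system G1} = graph_system G2"
  proof (intro equalityI subsetI)
    fix B assume "B \<in> {cmat_adjoint U ** A ** U | A. A \<in> graph_system G1}"
    then obtain A where "A \<in> graph_system G1" "B = cmat_adjoint U ** A ** U" by blast
    then show "B \<in> graph_system G2"
      unfolding mem_graph_system_iff conj mem[symmetric] by simp
  next
    fix B assume B: "B \<in> graph_system G2"
    define A where "A = (\<chi> i j. B $ \<pi> i $ \<pi> j)"
    have "A \<in> graph_system G1"
      using B unfolding mem_graph_system_iff mem[symmetric] by (simp add: A_def \<rho>)
    moreover have "B = cmat_adjoint U ** A ** U"
      by (simp add: conj A_def \<rho> vec_eq_iff)
    ultimately show "B \<in> {cmat_adjoint U ** A ** U | A. A \<in> graph_system G1}" by blast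
  qed
  ultimately show ?thesis by (auto simp: unitary_mat_def)
qed

section \<open>Completely positive maps on graph systems have a Kraus form\<close>

text \<open>
  The quadratic form of a block matrix whose blocks are indexed by a finite type instead of an
  initial segment of the natural numbers. This permits \<open>M\<^sub>2(S)\<close> to be indexed by \<^typ>\<open>bool\<close>, and
  \<open>M\<^sub>m(S)\<close> by the index type of the matrices of size \<open>m\<close>.
\<close>

definition block_form :: "('k::finite \<Rightarrow> 'k \<Rightarrow> complex^'n^'n) \<Rightarrow> ('k \<Rightarrow> complex^'n) \<Rightarrow> complex" where
  "block_form X \<xi> = (\<Sum>(s, t)\<in>UNIV. \<Sum>(a, b)\<in>UNIV. X s t $ a $ b * \<xi> t $ b * cnj (\<xi> s $ a))"

lemma completely_positive_block_form:
  fixes X :: "'k::finite \<Rightarrow> 'k \<Rightarrow> complex^'n::finite^'n"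
    and \<phi> :: "complex^'n^'n \<Rightarrow> complex^'m::finite^'m"
  assumes cp: "completely_positive S T \<phi>" and X: "\<And>s t. X s t \<in> S"
    and pos: "\<And>\<xi>. block_form X \<xi> \<in> \<real>\<^sub>\<ge>\<^sub>0"
  shows "block_form (\<lambda>s t. \<phi> (X s t)) \<xi> \<in> \<real>\<^sub>\<ge>\<^sub>0"
proof -
  define k where "k = CARD('k)"
  obtain g :: "nat \<Rightarrow> 'k" where g: "bij_betw g {..<k} UNIV"
    using ex_bij_betw_nat_finite[of "UNIV :: 'k set"] by (auto simp: k_def atLeast0LessThan)
  define h where "h = inv_into {..<k} g"
  have h: "h (g i) = i" if "i < k" for i
    using g that by (simp add: h_def bij_betw_inv_into_left)
  have reindex: "(\<Sum>i<k. \<Sum>j<k. F (g i) (g j)) = (\<Sum>(s, t)\<in>UNIV. F s t)" for F :: "'k \<Rightarrow> 'k \<Rightarrow> complex"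
  proof -
    have "(\<Sum>i<k. \<Sum>j<k. F (g i) (g j)) = (\<Sum>s\<in>UNIV. \<Sum>t\<in>UNIV. F s t)"
      unfolding sum.reindex_bij_betw[OF g, of "F _"]
      by (rule sum.reindex_bij_betw[OF g, of "\<lambda>s. \<Sum>t\<in>UNIV. F s t"])
    then show ?thesis by (simp add: sum.cartesian_product)
  qed
  have "positive_block k (\<lambda>i j. X (g i) (g j))"
    unfolding positive_block_def
  proof
    fix \<eta> :: "nat \<Rightarrow> complex^'n"
    have "(\<Sum>i<k. cvec_inner (\<Sum>j<k. X (g i) (g j) *v \<eta> j) (\<eta> i)) = block_form X (\<lambda>s. \<eta> (h s))"
      unfolding block_form_expand block_form_def reindex[symmetric]
      by (intro sum.cong refl) (simp add: h)
    then show "(\<Sum>i<k. cvec_inner (\<Sum>j<k. X (g i) (g j) *v \<eta> j) (\<eta> i)) \<in> \<real>\<^sub>\<ge>\<^sub>0"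
      using pos by simp
  qed
  then have "(\<lambda>i j. X (g i) (g j)) \<in> matrix_cone k S"
    using X by (simp add: matrix_cone_def)
  then have "(\<lambda>i j. \<phi> (X (g i) (g j))) \<in> matrix_cone k T"
    using cp unfolding completely_positive_def by (auto dest: bspec)
  then have "positive_block k (\<lambda>i j. \<phi> (X (g i) (g j)))"
    by (simp add: matrix_cone_def)
  then have "(\<Sum>i<k. cvec_inner (\<Sum>j<k. \<phi> (X (g i) (g j)) *v \<xi> (g j)) (\<xi> (g i))) \<in> \<real>\<^sub>\<ge>\<^sub>0"
    unfolding positive_block_def by (rule spec[where x = "\<lambda>i. \<xi> (g i)"])
  then show ?thesis
    unfolding block_form_expand block_form_def reindex[symmetric] .
qed

lemma two_by_two_polarization:
  fixes p q r s :: complex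
  assumes "\<And>x y. p * x * cnj x + q * y * cnj x + r * x * cnj y + s * y * cnj y \<in> \<real>"
  shows "r = cnj q"
proof -
  have "p \<in> \<real>" "s \<in> \<real>" "p + q + r + s \<in> \<real>" "p + q * \<i> - r * \<i> - s * \<i> * \<i> \<in> \<real>"
    using assms[of 1 0] assms[of 0 1] assms[of 1 1] assms[of 1 \<i>] by simp_all
  then have "Im p = 0" "Im s = 0" "Im (p + q + r + s) = 0" "Im (p + q * \<i> - r * \<i> - s * \<i> * \<i>) = 0"
    by (simp_all only: complex_is_Real_iff)
  then show ?thesis
    by (simp add: complex_eq_iff)
qed

lemma sum_bool_pairs:
  fixes F :: "bool \<Rightarrow> bool \<Rightarrow> 'a::comm_monoid_add"
  shows "(\<Sum>(s, t)\<in>UNIV. F s t) = F False False + F False True + F True False + F True True"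
proof -
  have "(\<Sum>(s, t)\<in>UNIV. F s t) = (\<Sum>s\<in>UNIV. \<Sum>t\<in>UNIV. F s t)"
    by (simp add: sum.cartesian_product)
  then show ?thesis by (simp add: UNIV_bool add.assoc)
qed

text \<open>
  The block matrix with rows \<open>(E\<^sub>i\<^sub>i, E\<^sub>i\<^sub>j)\<close> and \<open>(E\<^sub>j\<^sub>i, E\<^sub>j\<^sub>j)\<close> is positive, since its quadratic form is
  the squared modulus of a sum of two coordinates. Its image is therefore positive, hence
  self-adjoint.
\<close>

lemma completely_positive_adjoint:
  fixes G :: "('n::finite \<times> 'n) set" and \<phi> :: "complex^'n^'n \<Rightarrow> complex^'m::finite^'m"
  assumes cp: "completely_positive (graph_system G) T \<phi>" and G: "is_graph G"
    and ij: "(i, j) \<in> G \<union> Id"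
  shows "\<phi> (matrix_unit j i) $ b $ a = cnj (\<phi> (matrix_unit i j) $ a $ b)"
proof -
  define h where "h = (\<lambda>s. if s then j else i)"
  define X where "X = (\<lambda>s t. matrix_unit (h s) (h t) :: complex^'n^'n)"
  have X: "X s t \<in> graph_system G" for s t
    using ij G unfolding X_def h_def
    by (intro matrix_unit_mem_graph_system) (auto simp: is_graph_def sym_def)
  have "block_form X \<xi> \<in> \<real>\<^sub>\<ge>\<^sub>0" for \<xi>
  proof -
    have entry: "(\<Sum>(a, b)\<in>UNIV. X s t $ a $ b * \<xi> t $ b * cnj (\<xi> s $ a))
        = \<xi> t $ h t * cnj (\<xi> s $ h s)" for s t
    proof -
      have "(\<Sum>(a, b)\<in>UNIV. X s t $ a $ b * \<xi> t $ b * cnj (\<xi> s $ a))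
         = (\<Sum>p\<in>UNIV. if p = (h s, h t) then \<xi> t $ h t * cnj (\<xi> s $ h s) else 0)"
        by (rule sum.cong) (auto simp: X_def split: if_splits)
      then show ?thesis by simp
    qed
    have "block_form X \<xi> = (\<Sum>t\<in>UNIV. \<xi> t $ h t) * cnj (\<Sum>t\<in>UNIV. \<xi> t $ h t)"
      unfolding block_form_def entry
      unfolding sum_bool_pairs by (simp add: UNIV_bool algebra_simps)
    also have "\<dots> = complex_of_real ((cmod (\<Sum>t\<in>UNIV. \<xi> t $ h t))\<^sup>2)"
      by (rule complex_norm_square[symmetric])
    finally show ?thesis by simp
  qed
  then have pos: "block_form (\<lambda>s t. \<phi> (X s t)) \<xi> \<in> \<real>\<^sub>\<ge>\<^sub>0" for \<xi>
    by (intro completely_positive_block_form[OF cp, where X = X] X)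
  show ?thesis
  proof (rule two_by_two_polarization)
    fix x y
    define \<xi> :: "bool \<Rightarrow> complex^'m"
      where "\<xi> = (\<lambda>s. \<chi> c. if s then (if c = b then y else 0) else (if c = a then x else 0))"
    define k where "k = (\<lambda>s. if s then b else a)"
    define z where "z = (\<lambda>s. if s then y else x)"
    have \<xi>: "\<xi> s $ c = (if c = k s then z s else 0)" for s c
      by (simp add: \<xi>_def k_def z_def)
    have entry: "(\<Sum>(a, b)\<in>UNIV. \<phi> (X s t) $ a $ b * \<xi> t $ b * cnj (\<xi> s $ a))
        = \<phi> (X s t) $ k s $ k t * z t * cnj (z s)" for s t
    proof -
      have "(\<Sum>(a, b)\<in>UNIV. \<phi> (X s t) $ a $ b * \<xi> t $ b * cnj (\<xi> s $ a))
         = (\<Sum>p\<in>UNIV. if p = (k s, k t) then \<phi> (X s t) $ k s $ k t * z t * cnj (z s) else 0)"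
        by (rule sum.cong) (auto simp: \<xi> split: if_splits)
      then show ?thesis by simp
    qed
    have "block_form (\<lambda>s t. \<phi> (X s t)) \<xi> = 
        \<phi> (matrix_unit i i) $ a $ a * x * cnj x + \<phi> (matrix_unit i j) $ a $ b * y * cnj x +
        \<phi> (matrix_unit j i) $ b $ a * x * cnj y + \<phi> (matrix_unit j j) $ b $ b * y * cnj y"
      unfolding block_form_def entry
      unfolding sum_bool_pairs by (simp add: X_def h_def k_def z_def)
    then show "\<phi> (matrix_unit i i) $ a $ a * x * cnj x + \<phi> (matrix_unit i j) $ a $ b * y * cnj x +
        \<phi> (matrix_unit j i) $ b $ a * x * cnj y + \<phi> (matrix_unit j j) $ b $ b * y * cnj y \<in> \<real>"
      using pos[of \<xi>] nonneg_Reals_subset_Reals by auto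
  qed
qed

text \<open>
  The values of \<open>A \<mapsto> V\<^sup>* A V\<close> on the matrix units \<open>E\<^sub>p\<close> with \<open>p \<in> E\<close>: the entry at \<open>p, q\<close> is the
  entry of \<open>V\<^sup>* E\<^sub>p V\<close> at \<open>q\<close>. Collecting these values in one matrix puts them in a Euclidean space,
  where convex sets can be separated from points.
\<close>

definition kraus_array :: "('n::finite \<times> 'n) set \<Rightarrow> complex^'m::finite^'n \<Rightarrow> complex^('m \<times> 'm)^('n \<times> 'n)" where
  "kraus_array E V = (\<chi> p q. if p \<in> E then cnj (V $ fst p $ fst q) * V $ snd p $ snd q else 0)"

lemma norm_cmat_square:
  fixes V :: "complex^'m::finite^'n::finite"
  shows "(norm V)\<^sup>2 = (\<Sum>i\<in>UNIV. \<Sum>a\<in>UNIV. (cmod (V $ i $ a))\<^sup>2)"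
  by (simp add: power2_norm_eq_inner inner_vec_def)

lemma kraus_array_scaleR: "kraus_array E (c *\<^sub>R V) = c\<^sup>2 *\<^sub>R kraus_array E V"
proof -
  have sc: "cnj (c *\<^sub>R x) * (c *\<^sub>R y) = c\<^sup>2 *\<^sub>R (cnj x * y)" for x y :: complex
    by (simp add: scaleR_conv_of_real power2_eq_square)
  have "kraus_array E (c *\<^sub>R V) $ p $ q = (c\<^sup>2 *\<^sub>R kraus_array E V) $ p $ q" for p q
    unfolding kraus_array_def vec_lambda_beta vector_scaleR_component sc by simp
  then show ?thesis by (simp add: vec_eq_iff)
qed

lemma compact_kraus_arrays:
  fixes E :: "('n::finite \<times> 'n) set"
  shows "compact (kraus_array E ` (sphere 0 1 :: (complex^'m::finite^'n) set))"
proof (rule compact_continuous_image)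
  have entry: "continuous_on (sphere 0 1) (\<lambda>V::complex^'m^'n. V $ i $ a)" for i a
    by (intro continuous_on_component continuous_on_id)
  have "continuous_on (sphere 0 1) (\<lambda>V::complex^'m^'n. if p \<in> E then cnj (V $ fst p $ fst q) * V $ snd p $ snd q else 0)"
    for p q
  proof (cases "p \<in> E")
    case True
    then show ?thesis
      using continuous_on_mult[OF continuous_on_cnj[OF entry] entry] by simp
  qed simp
  then show "continuous_on (sphere 0 1) (kraus_array E :: complex^'m^'n \<Rightarrow> _)"
    unfolding kraus_array_def by (intro continuous_on_vec_lambda)
qed (rule compact_sphere)

text \<open>
  A real-linear functional \<open>R \<mapsto> inner H R - c \<cdot> trace R\<close> on arrays, read as an \<open>m \<times> m\<close> block matrix.
  On \<open>E\<close> the coefficients of \<open>H\<close> are symmetrized, which makes the block matrix self-adjoint; off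
  \<open>E\<close> they are dropped, which puts the blocks in the graph system.
\<close>

definition dual_block ::
    "('n::finite \<times> 'n) set \<Rightarrow> complex^('m::finite \<times> 'm)^('n \<times> 'n) \<Rightarrow> real \<Rightarrow> 'm \<Rightarrow> 'm \<Rightarrow> complex^'n^'n" where
  "dual_block E H c a b = (\<chi> i j.
     (if (i, j) \<in> E then (cnj (H $ (i, j) $ (a, b)) + H $ (j, i) $ (b, a)) / 2 else 0)
     - (if i = j \<and> a = b then complex_of_real c else 0))"

text \<open>
  Symmetrizing \<open>H\<close> replaces the complex pairing by its real part, because \<open>R\<close> is self-adjoint.
\<close>

lemma dual_block_pairing:
  fixes H R :: "complex^('m::finite \<times> 'm)^('n::finite \<times> 'n)"
  assumes supp: "\<And>p. p \<notin> E \<Longrightarrow> R $ p = 0"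
    and herm: "\<And>i j a b. R $ (j, i) $ (b, a) = cnj (R $ (i, j) $ (a, b))"
  shows "(\<Sum>(a, b)\<in>UNIV. \<Sum>(i, j)\<in>UNIV. dual_block E H c a b $ i $ j * R $ (i, j) $ (a, b))
       = complex_of_real (inner H R - c * (\<Sum>i\<in>UNIV. \<Sum>a\<in>UNIV. Re (R $ (i, i) $ (a, a))))"
proof -
  define sw :: "'n \<times> 'n \<Rightarrow> 'n \<times> 'n" where "sw = prod.swap"
  define sw' :: "'m \<times> 'm \<Rightarrow> 'm \<times> 'm" where "sw' = prod.swap"
  define P where "P = (\<Sum>q\<in>UNIV. \<Sum>p\<in>UNIV. cnj (H $ p $ q) * R $ p $ q)"
  define D where "D = (\<Sum>q\<in>UNIV. \<Sum>p\<in>UNIV.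
      (if fst p = snd p \<and> fst q = snd q then complex_of_real c * R $ p $ q else 0))"
  have R_sw: "R $ sw p $ sw' q = cnj (R $ p $ q)" for p q
    using herm[of "snd p" "fst p" "snd q" "fst q"] by (cases p; cases q) (simp add: sw_def sw'_def)
  have "(\<Sum>q\<in>UNIV. \<Sum>p\<in>UNIV. H $ sw p $ sw' q * R $ p $ q)
      = (\<Sum>q\<in>UNIV. \<Sum>p\<in>UNIV. H $ sw p $ sw' q * cnj (R $ sw p $ sw' q))"
    by (simp add: R_sw)
  also have "\<dots> = (\<Sum>q\<in>UNIV. \<Sum>p\<in>UNIV. H $ p $ sw' q * cnj (R $ p $ sw' q))"
    by (intro sum.cong refl sum.reindex_bij_betw[of sw]) (simp add: sw_def)
  also have "\<dots> = (\<Sum>q\<in>UNIV. \<Sum>p\<in>UNIV. H $ p $ q * cnj (R $ p $ q))"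
    by (rule sum.reindex_bij_betw[of sw' UNIV UNIV "\<lambda>q. \<Sum>p\<in>UNIV. H $ p $ q * cnj (R $ p $ q)"])
       (simp add: sw'_def)
  also have "\<dots> = cnj P" by (simp add: P_def)
  finally have cnjP: "(\<Sum>q\<in>UNIV. \<Sum>p\<in>UNIV. H $ sw p $ sw' q * R $ p $ q) = cnj P" .
  have "(\<Sum>(a, b)\<in>UNIV. \<Sum>(i, j)\<in>UNIV. dual_block E H c a b $ i $ j * R $ (i, j) $ (a, b))
      = (\<Sum>q\<in>UNIV. \<Sum>p\<in>UNIV. (cnj (H $ p $ q) * R $ p $ q + H $ sw p $ sw' q * R $ p $ q) / 2 -
          (if fst p = snd p \<and> fst q = snd q then complex_of_real c * R $ p $ q else 0))"
    by (intro sum.cong refl)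
       (auto simp: dual_block_def supp sw_def sw'_def field_simps intro!: sum.cong)
  also have "\<dots> = (P + cnj P) / 2 - D"
    unfolding cnjP[symmetric] unfolding P_def D_def
    by (simp add: sum.distrib sum_subtractf flip: sum_divide_distrib)
  also have "(P + cnj P) / 2 = complex_of_real (Re P)"
    by (simp add: complex_add_cnj)
  also have "Re P = inner H R"
    unfolding P_def inner_vec_def
    by (subst sum.swap) (simp add: inner_complex_def)
  also have "D = (\<Sum>(a, b)\<in>UNIV. \<Sum>(i, j)\<in>UNIV.
      if a = b then if i = j then complex_of_real c * R $ (i, i) $ (a, a) else 0 else 0)"
    unfolding D_def by (auto intro!: sum.cong)
  also have "\<dots> = (\<Sum>(a, b)\<in>UNIV. if a = b then \<Sum>(i, j)\<in>UNIV.
      if i = j then complex_of_real c * R $ (i, i) $ (a, a) else 0 else 0)"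
    by (auto intro!: sum.cong)
  also have "\<dots> = (\<Sum>a\<in>UNIV. \<Sum>i\<in>UNIV. complex_of_real c * R $ (i, i) $ (a, a))"
    by (simp add: sum.delta' flip: UNIV_Times_UNIV sum.cartesian_product)
  also have "\<dots> = (\<Sum>a\<in>UNIV. \<Sum>i\<in>UNIV. complex_of_real (c * Re (R $ (i, i) $ (a, a))))"
  proof (intro sum.cong refl)
    fix a i
    have "Im (R $ (i, i) $ (a, a)) = 0"
      using herm[where i = i and j = i and a = a and b = a] by (simp add: complex_eq_iff)
    then show "complex_of_real c * R $ (i, i) $ (a, a) = complex_of_real (c * Re (R $ (i, i) $ (a, a)))"
      by (simp add: complex_eq_iff)
  qed
  also have "\<dots> = complex_of_real (c * (\<Sum>i\<in>UNIV. \<Sum>a\<in>UNIV. Re (R $ (i, i) $ (a, a))))"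
    by (subst sum.swap) (simp add: sum_distrib_left)
  finally show ?thesis by simp
qed

lemma adjoint_mult_nth:
  fixes A :: "complex^'n::finite^'n" and V :: "complex^'m::finite^'n"
  shows "(cmat_adjoint V ** A ** V) $ a $ b
       = (\<Sum>(i, j)\<in>UNIV. A $ i $ j * (cnj (V $ i $ a) * V $ j $ b))"
proof -
  have "(cmat_adjoint V ** A ** V) $ a $ b
      = (\<Sum>j\<in>UNIV. \<Sum>i\<in>UNIV. A $ i $ j * (cnj (V $ i $ a) * V $ j $ b))"
    by (simp add: matrix_matrix_mult_def cmat_adjoint_def sum_distrib_left sum_distrib_right mult_ac)
  also have "\<dots> = (\<Sum>i\<in>UNIV. \<Sum>j\<in>UNIV. A $ i $ j * (cnj (V $ i $ a) * V $ j $ b))"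
    by (rule sum.swap)
  finally show ?thesis by (simp add: sum.cartesian_product)
qed

text \<open>
  The Choi matrix of \<open>\<phi>\<close>, restricted to the matrix units on which \<open>\<phi>\<close> is meaningful.
\<close>

definition choi_array ::
    "('n::finite \<times> 'n) set \<Rightarrow> (complex^'n^'n \<Rightarrow> complex^'m::finite^'m) \<Rightarrow> complex^('m \<times> 'm)^('n \<times> 'n)" where
  "choi_array E \<phi> = (\<chi> p q. if p \<in> E then \<phi> (matrix_unit (fst p) (snd p)) $ fst q $ snd q else 0)"

lemma clinear_between_choi_array:
  fixes G :: "('n::finite \<times> 'n) set" and \<phi> :: "complex^'n^'n \<Rightarrow> complex^'m::finite^'m"
  assumes lin: "clinear_between (graph_system G) T \<phi>" and A: "A \<in> graph_system G"
  shows "\<phi> A $ a $ b = (\<Sum>(i, j)\<in>UNIV. A $ i $ j * choi_array (G \<union> Id) \<phi> $ (i, j) $ (a, b))"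
proof -
  have "\<phi> A $ a $ b = (\<Sum>p\<in>G \<union> Id. A $ fst p $ snd p * \<phi> (matrix_unit (fst p) (snd p)) $ a $ b)"
    by (subst clinear_between_graph_system_expansion[OF lin A]) (simp add: cmat_scale_def)
  also have "\<dots> = (\<Sum>p\<in>UNIV. A $ fst p $ snd p * choi_array (G \<union> Id) \<phi> $ p $ (a, b))"
    by (rule sum.mono_neutral_cong_left) (auto simp: choi_array_def)
  finally show ?thesis by (simp add: case_prod_beta)
qed

text \<open>
  Both sides are homogeneous of degree two in \<open>V\<close>, so the bound extends from the unit sphere.
\<close>

lemma inner_kraus_array_ge_norm_square:
  fixes V :: "complex^'m::finite^'n::finite"
  assumes "\<And>W::complex^'m^'n. norm W = 1 \<Longrightarrow> c < inner H (kraus_array E W)"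
  shows "c * (norm V)\<^sup>2 \<le> inner H (kraus_array E V)"
proof (cases "V = 0")
  case True
  then have "kraus_array E V = 0" by (simp add: kraus_array_def vec_eq_iff)
  with True show ?thesis by simp
next
  case False
  have "kraus_array E V = kraus_array E (norm V *\<^sub>R sgn V)"
    using False by (simp add: sgn_div_norm)
  then have "inner H (kraus_array E V) = (norm V)\<^sup>2 * inner H (kraus_array E (sgn V))"
    by (simp only: kraus_array_scaleR inner_scaleR_right)
  moreover have "c < inner H (kraus_array E (sgn V))"
    using False by (intro assms) (simp add: norm_sgn)
  ultimately show ?thesis
    using mult_right_mono[of c "inner H (kraus_array E (sgn V))" "(norm V)\<^sup>2"]
    by (simp add: mult.commute)
qed

text \<open>
  The arrays of the matrices \<open>V\<close> of norm one form a compact set, and so does their convex hull.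
  If the normalized Choi array of \<open>\<phi>\<close> were outside it, a hyperplane would separate the two strictly:
  the functional \<open>R \<mapsto> inner H R - c \<cdot> trace R\<close> is nonnegative on every \<open>kraus_array E V\<close>, so its
  block matrix is a positive element over the graph system. Its value at the Choi array is negative,
  and this value is the quadratic form of the image block matrix at the vector whose \<open>b\<close>-th
  component is the \<open>b\<close>-th standard basis vector; so the image is not positive.

  The normalization comes from the trace of the Choi array, which is the trace \<open>m\<close> of \<open>\<phi>(1) = 1\<close>, while the array of \<open>V\<close> has trace
  \<open>\<parallel>V\<parallel>\<^sup>2\<close>.
\<close>

lemma choi_array_mem_convex_hull:
  fixes G :: "('n::finite \<times> 'n) set" and \<phi> :: "complex^'n^'n \<Rightarrow> complex^'m::finite^'m"
  assumes G: "is_graph G" and cp: "completely_positive (graph_system G) T \<phi>"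
    and unital: "\<phi> (mat 1) = mat 1"
  shows "(1 / real CARD('m)) *\<^sub>R choi_array (G \<union> Id) \<phi>
           \<in> convex hull (kraus_array (G \<union> Id) ` (sphere 0 1 :: (complex^'m^'n) set))"
proof (rule ccontr)
  define E where "E = G \<union> Id"
  define N where "N = real CARD('m)"
  define R where "R = choi_array E \<phi>"
  let ?K = "convex hull (kraus_array E ` (sphere 0 1 :: (complex^'m^'n) set))"
  have N: "N > 0" by (simp add: N_def)
  have symE: "(j, i) \<in> E" if "(i, j) \<in> E" for i j
    using that G by (auto simp: E_def is_graph_def sym_def)
  have lin: "clinear_between (graph_system G) T \<phi>"
    using cp by (simp add: completely_positive_def)
  assume "\<not> ?thesis"
  then have notin: "(1 / N) *\<^sub>R R \<notin> ?K" by (simp add: E_def N_def R_def)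
  have "closed ?K"
    by (intro compact_imp_closed compact_convex_hull compact_kraus_arrays)
  from separating_hyperplane_closed_point[OF convex_convex_hull this notin]
  obtain H c where below: "inner H ((1 / N) *\<^sub>R R) < c" and above: "\<And>y. y \<in> ?K \<Longrightarrow> c < inner H y"
    by blast
  have sphere: "c < inner H (kraus_array E W)" if "norm W = 1" for W :: "complex^'m^'n"
    using that by (intro above hull_inc imageI) simp
  define Y where "Y = dual_block E H c"
  have Y: "Y a b \<in> graph_system G" for a b
    by (auto simp: Y_def dual_block_def mem_graph_system_iff E_def)
  have pos: "block_form Y \<xi> \<in> \<real>\<^sub>\<ge>\<^sub>0" for \<xi>
  proof -
    define V :: "complex^'m^'n" where "V = (\<chi> i a. \<xi> a $ i)"
    have "block_form Y \<xi> = (\<Sum>(a, b)\<in>UNIV. \<Sum>(i, j)\<in>UNIV. Y a b $ i $ j * kraus_array E V $ (i, j) $ (a, b))"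
      unfolding block_form_def
      by (intro sum.cong refl)
         (auto simp: kraus_array_def V_def Y_def dual_block_def E_def intro!: sum.cong)
    also have "\<dots> = complex_of_real (inner H (kraus_array E V)
        - c * (\<Sum>i\<in>UNIV. \<Sum>a\<in>UNIV. Re (kraus_array E V $ (i, i) $ (a, a))))"
      unfolding Y_def
      by (rule dual_block_pairing) (auto simp: kraus_array_def vec_eq_iff symE)
    also have "(\<Sum>i\<in>UNIV. \<Sum>a\<in>UNIV. Re (kraus_array E V $ (i, i) $ (a, a))) = (norm V)\<^sup>2"
      unfolding norm_cmat_square cmod_power2
      by (simp add: kraus_array_def E_def power2_eq_square)
    finally show ?thesis
      using inner_kraus_array_ge_norm_square[OF sphere, of V]
      by (simp del: of_real_diff of_real_mult of_real_power)
  qed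
  (* At this vector the quadratic form of the image picks out the pairing with the Choi array. *)
  define e :: "'m \<Rightarrow> complex^'m" where "e = (\<lambda>b. axis b 1)"
  have "block_form (\<lambda>a b. \<phi> (Y a b)) e \<in> \<real>\<^sub>\<ge>\<^sub>0"
    by (rule completely_positive_block_form[OF cp Y pos])
  also have "block_form (\<lambda>a b. \<phi> (Y a b)) e = (\<Sum>(a, b)\<in>UNIV. \<phi> (Y a b) $ a $ b)"
  proof -
    have "(\<Sum>(i, j)\<in>UNIV. \<phi> (Y a b) $ i $ j * e b $ j * cnj (e a $ i)) = \<phi> (Y a b) $ a $ b" for a b
    proof -
      have "(\<Sum>(i, j)\<in>UNIV. \<phi> (Y a b) $ i $ j * e b $ j * cnj (e a $ i))
         = (\<Sum>p\<in>UNIV. if p = (a, b) then \<phi> (Y a b) $ a $ b else 0)"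
        by (rule sum.cong) (auto simp: e_def axis_def split: if_splits)
      then show ?thesis by simp
    qed
    then show ?thesis by (simp add: block_form_def)
  qed
  also have "\<dots> = (\<Sum>(a, b)\<in>UNIV. \<Sum>(i, j)\<in>UNIV. Y a b $ i $ j * R $ (i, j) $ (a, b))"
    unfolding clinear_between_choi_array[OF lin Y] R_def E_def ..
  also have "\<dots> = complex_of_real (inner H R - c * (\<Sum>i\<in>UNIV. \<Sum>a\<in>UNIV. Re (R $ (i, i) $ (a, a))))"
    unfolding Y_def
  proof (rule dual_block_pairing)
    show "R $ (j, i) $ (b, a) = cnj (R $ (i, j) $ (a, b))" for i j a b
    proof (cases "(i, j) \<in> E")
      case True
      then show ?thesis
        using symE[OF True] completely_positive_adjoint[OF cp G, of i j b a]
        by (simp add: R_def choi_array_def E_def)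
    next
      case False
      then have "(j, i) \<notin> E" using symE by blast
      with False show ?thesis by (simp add: R_def choi_array_def)
    qed
  qed (simp add: R_def choi_array_def vec_eq_iff)
  also have "(\<Sum>i\<in>UNIV. \<Sum>a\<in>UNIV. Re (R $ (i, i) $ (a, a))) = N"
  proof -
    have "mat 1 \<in> graph_system G" by (auto simp: mem_graph_system_iff mat_def)
    note \<phi>1 = clinear_between_choi_array[OF lin this]
    have one: "1 = (\<Sum>i\<in>UNIV. R $ (i, i) $ (a, a))" for a
    proof -
      have "1 = (\<Sum>(i, j)\<in>UNIV. mat 1 $ i $ j * R $ (i, j) $ (a, a))"
        using \<phi>1[of a a] unfolding unital R_def E_def by (simp add: mat_def)
      also have "\<dots> = (\<Sum>i\<in>UNIV. \<Sum>j\<in>UNIV. mat 1 $ i $ j * R $ (i, j) $ (a, a))"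
        by (simp add: sum.cartesian_product)
      also have "\<dots> = (\<Sum>i\<in>UNIV. \<Sum>j\<in>UNIV. if i = j then R $ (i, j) $ (a, a) else 0)"
        by (intro sum.cong refl) (simp add: mat_def)
      finally show ?thesis by simp
    qed
    have "(\<Sum>i\<in>UNIV. \<Sum>a\<in>UNIV. Re (R $ (i, i) $ (a, a))) = (\<Sum>a\<in>UNIV. Re (\<Sum>i\<in>UNIV. R $ (i, i) $ (a, a)))"
      by (subst sum.swap) simp
    also have "\<dots> = N" by (simp add: N_def flip: one)
    finally show ?thesis .
  qed
  finally have "c * N \<le> inner H R"
    by (simp del: of_real_diff of_real_mult)
  moreover have "inner H R < c * N"
    using below N by (simp add: divide_simps)
  ultimately show False by simp
qed

text \<open>
  A convex combination of arrays is a Kraus form once each coefficient is multiplied by \<open>m\<close>, which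
  undoes the normalization, and the square root of the product is absorbed into the matrix belonging
  to it.
\<close>

theorem completely_positive_kraus_form:
  fixes G :: "('n::finite \<times> 'n) set" and \<phi> :: "complex^'n^'n \<Rightarrow> complex^'m::finite^'m"
  assumes G: "is_graph G" and cp: "completely_positive (graph_system G) T \<phi>"
    and unital: "\<phi> (mat 1) = mat 1"
  obtains K :: nat and V :: "nat \<Rightarrow> complex^'m^'n"
  where "\<And>A. A \<in> graph_system G \<Longrightarrow> \<phi> A = (\<Sum>k<K. cmat_adjoint (V k) ** A ** V k)"
proof -
  define E where "E = G \<union> Id"
  define N where "N = real CARD('m)"
  define R where "R = choi_array E \<phi>"
  have N: "N > 0" by (simp add: N_def)
  have "(1 / N) *\<^sub>R R \<in> convex hull (kraus_array E ` (sphere 0 1 :: (complex^'m^'n) set))"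
    unfolding N_def R_def E_def by (rule choi_array_mem_convex_hull[OF G cp unital])
  then obtain F u where F: "finite F" "F \<subseteq> kraus_array E ` (sphere 0 1 :: (complex^'m^'n) set)"
    and u: "\<forall>v\<in>F. 0 \<le> u v" and sum: "(\<Sum>v\<in>F. u v *\<^sub>R v) = (1 / N) *\<^sub>R R"
    unfolding convex_hull_explicit by blast
  obtain W :: "_ \<Rightarrow> complex^'m^'n" where W: "\<And>v. v \<in> F \<Longrightarrow> kraus_array E (W v) = v"
    using F(2) by (metis (no_types, lifting) f_inv_into_f subsetD)
  obtain g where g: "bij_betw g {..<card F} F"
    using ex_bij_betw_nat_finite[OF F(1)] by (auto simp: atLeast0LessThan)
  define V where "V = (\<lambda>k. sqrt (N * u (g k)) *\<^sub>R W (g k))"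
  have gF: "g k \<in> F" if "k < card F" for k
    using g that by (auto simp: bij_betw_def)
  have "kraus_array E (V k) = N *\<^sub>R (u (g k) *\<^sub>R g k)" if "k < card F" for k
    using gF[OF that] u N by (simp add: V_def kraus_array_scaleR W)
  then have "(\<Sum>k<card F. kraus_array E (V k)) = (\<Sum>k<card F. N *\<^sub>R (u (g k) *\<^sub>R g k))"
    by (intro sum.cong) auto
  also have "\<dots> = (\<Sum>v\<in>F. N *\<^sub>R (u v *\<^sub>R v))"
    by (rule sum.reindex_bij_betw[OF g])
  also have "\<dots> = R"
    unfolding scaleR_sum_right[symmetric] sum using N by simp
  finally have R: "(\<Sum>k<card F. kraus_array E (V k)) = R" .
  show thesis
  proof (rule that)
    fix A assume A: "A \<in> graph_system G"
    have lin: "clinear_between (graph_system G) T \<phi>"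
      using cp by (simp add: completely_positive_def)
    have "\<phi> A $ a $ b = (\<Sum>k<card F. cmat_adjoint (V k) ** A ** V k) $ a $ b" for a b
    proof -
      have "\<phi> A $ a $ b = (\<Sum>p\<in>UNIV. A $ fst p $ snd p * R $ p $ (a, b))"
        unfolding clinear_between_choi_array[OF lin A] R_def E_def by (simp add: case_prod_beta)
      also have "\<dots> = (\<Sum>p\<in>UNIV. \<Sum>k<card F. A $ fst p $ snd p * kraus_array E (V k) $ p $ (a, b))"
        unfolding R[symmetric] by (simp add: sum_distrib_left)
      also have "\<dots> = (\<Sum>k<card F. \<Sum>p\<in>UNIV. A $ fst p $ snd p * kraus_array E (V k) $ p $ (a, b))"
        by (rule sum.swap)
      also have "\<dots> = (\<Sum>k<card F. (cmat_adjoint (V k) ** A ** V k) $ a $ b)"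
      proof (intro sum.cong refl)
        fix k
        have "A $ fst p $ snd p * kraus_array E (V k) $ p $ (a, b)
            = A $ fst p $ snd p * (cnj (V k $ fst p $ a) * V k $ snd p $ b)" for p
          using A by (cases p) (auto simp: kraus_array_def E_def mem_graph_system_iff)
        then show "(\<Sum>p\<in>UNIV. A $ fst p $ snd p * kraus_array E (V k) $ p $ (a, b))
            = (cmat_adjoint (V k) ** A ** V k) $ a $ b"
          unfolding adjoint_mult_nth case_prod_beta by (rule sum.cong[OF refl])
      qed
      finally show ?thesis by simp
    qed
    then show "\<phi> A = (\<Sum>k<card F. cmat_adjoint (V k) ** A ** V k)"
      by (simp add: vec_eq_iff)
  qed
qed

section \<open>Kraus matrices of maps that fix a graph system\<close>

text \<open>
  With coefficients \<open>t k = z ^ k\<close> the combinations become finitely many nonzero polynomials in \<open>z\<close>,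
  which have only finitely many roots.
\<close>

lemma obtain_nonvanishing_combination:
  fixes d :: "'i::finite \<Rightarrow> nat \<Rightarrow> complex"
  assumes "\<And>i. \<exists>k<K. d i k \<noteq> 0"
  obtains t :: "nat \<Rightarrow> complex" where "\<And>i. (\<Sum>k<K. t k * d i k) \<noteq> 0"
proof -
  have "finite {z. (\<Sum>k<K. z ^ k * d i k) = 0}" for i
  proof -
    define c where "c = (\<lambda>k. if k < K then d i k else 0)"
    have "(\<Sum>k\<le>K. c k * z ^ k) = (\<Sum>k<K. z ^ k * d i k)" for z
      unfolding c_def by (rule sum.mono_neutral_cong_right) auto
    moreover have "finite {z. (\<Sum>k\<le>K. c k * z ^ k) = 0}"
      using assms[of i] by (subst polyfun_finite_roots) (auto simp: c_def)
    ultimately show ?thesis by simp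
  qed
  then have "finite (\<Union>i. {z. (\<Sum>k<K. z ^ k * d i k) = 0})"
    by (intro finite_UN_I) auto
  then obtain z where "z \<notin> (\<Union>i. {z. (\<Sum>k<K. z ^ k * d i k) = 0})"
    using ex_new_if_finite[OF infinite_UNIV_char_0] by blast
  then show thesis by (intro that[of "\<lambda>k. z ^ k"]) auto
qed

lemma adjoint_mult_matrix_unit_nth:
  fixes V :: "complex^'m::finite^'n::finite"
  shows "(cmat_adjoint V ** matrix_unit i j ** V) $ a $ b = cnj (V $ i $ a) * V $ j $ b"
proof -
  have "(cmat_adjoint V ** matrix_unit i j ** V) $ a $ b
      = (\<Sum>p\<in>UNIV. if p = (i, j) then cnj (V $ i $ a) * V $ j $ b else 0)"
    unfolding adjoint_mult_nth by (rule sum.cong) (auto split: if_splits)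
  then show ?thesis by simp
qed

text \<open>
  The entries of the equation for \<open>E\<^sub>i\<^sub>j\<close> say that \<open>\<Sum>\<^sub>x cnj (M\<^sub>x)\<^sub>i\<^sub>a (M\<^sub>x)\<^sub>j\<^sub>b\<close> is \<open>1\<close> for \<open>(a, b) = (i, j)\<close>
  and \<open>0\<close> otherwise. Taking \<open>i = j\<close> and \<open>a = b \<noteq> i\<close> shows that all \<open>M\<^sub>x\<close> are diagonal, and that
  the families \<open>((M\<^sub>x)\<^sub>i\<^sub>i)\<^sub>x\<close> are unit vectors. For an edge \<open>(i, j)\<close> the inner product of two such unit
  vectors is \<open>1\<close>, so they are equal.
\<close>

lemma
  fixes M :: "'x \<Rightarrow> complex^'n::finite^'n"
  assumes I: "finite I"
    and fixed: "\<And>i j. (i, j) \<in> G \<union> Id \<Longrightarrow>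
      (\<Sum>x\<in>I. cmat_adjoint (M x) ** matrix_unit i j ** M x) = matrix_unit i j"
  shows kraus_fixed_diagonal: "x \<in> I \<Longrightarrow> a \<noteq> i \<Longrightarrow> M x $ i $ a = 0"
    and kraus_fixed_edge: "x \<in> I \<Longrightarrow> (i, j) \<in> G \<Longrightarrow> M x $ i $ i = M x $ j $ j"
    and kraus_fixed_nonzero: "\<exists>x\<in>I. M x $ i $ i \<noteq> 0"
proof -
  have entry: "(\<Sum>x\<in>I. cnj (M x $ i $ a) * M x $ j $ b) = (if a = i \<and> b = j then 1 else 0)"
    if "(i, j) \<in> G \<union> Id" for i j a b
    using arg_cong[OF fixed[OF that], of "\<lambda>A. A $ a $ b"]
    by (simp add: adjoint_mult_matrix_unit_nth)
  have null: "f x = 0" if "(\<Sum>x\<in>I. cnj (f x) * f x) = 0" "x \<in> I" for f :: "'x \<Rightarrow> complex" and x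
  proof -
    have "(\<Sum>x\<in>I. cnj (f x) * f x) = complex_of_real (\<Sum>x\<in>I. (cmod (f x))\<^sup>2)"
      by (simp add: complex_norm_square mult.commute del: of_real_power)
    then have "(\<Sum>x\<in>I. (cmod (f x))\<^sup>2) = 0" using that(1) by (metis of_real_eq_0_iff)
    then show ?thesis using I that(2) by (simp add: sum_nonneg_eq_0_iff)
  qed
  show "M x $ i $ a = 0" if "x \<in> I" "a \<noteq> i"
    using null[of "\<lambda>x. M x $ i $ a" x] entry[of i i a a] that by simp
  have one: "(\<Sum>x\<in>I. cnj (M x $ i $ i) * M x $ i $ i) = 1" for i
    using entry[of i i i i] by simp
  show "\<exists>x\<in>I. M x $ i $ i \<noteq> 0"
    using one[of i] by (metis (no_types, lifting) mult_zero_right sum.neutral zero_neq_one)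
  show "M x $ i $ i = M x $ j $ j" if x: "x \<in> I" and ij: "(i, j) \<in> G"
  proof -
    have ij1: "(\<Sum>x\<in>I. cnj (M x $ i $ i) * M x $ j $ j) = 1"
      using entry[of i j i j] ij by simp
    then have "cnj (\<Sum>x\<in>I. cnj (M x $ i $ i) * M x $ j $ j) = 1" by simp
    then have ji1: "(\<Sum>x\<in>I. cnj (M x $ j $ j) * M x $ i $ i) = 1"
      by (simp add: mult.commute)
    have "(\<Sum>x\<in>I. cnj (M x $ i $ i - M x $ j $ j) * (M x $ i $ i - M x $ j $ j)) =
        (\<Sum>x\<in>I. cnj (M x $ i $ i) * M x $ i $ i) + (\<Sum>x\<in>I. cnj (M x $ j $ j) * M x $ j $ j)
        - (\<Sum>x\<in>I. cnj (M x $ i $ i) * M x $ j $ j) - (\<Sum>x\<in>I. cnj (M x $ j $ j) * M x $ i $ i)"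
      by (simp add: algebra_simps sum.distrib sum_subtractf)
    also have "\<dots> = 0" by (simp only: one ij1 ji1) simp
    finally show ?thesis using null[of "\<lambda>x. M x $ i $ i - M x $ j $ j" x] x by simp
  qed
qed

text \<open>
  Generic coefficients make \<open>Z Y\<close> an invertible diagonal matrix, where \<open>Z = \<Sum>\<^sub>k t\<^sub>k V\<^sub>k\<close> and
  \<open>Y = \<Sum>\<^sub>l s\<^sub>l W\<^sub>l\<close>. They can be chosen one family after the other: first \<open>s\<close> such that for each \<open>i\<close>
  some diagonal matrix \<open>V\<^sub>k Y\<close> is nonzero at \<open>i\<close>, then \<open>t\<close>. The matrices \<open>D\<^sub>k = V\<^sub>k Y (Z Y)\<^sup>-\<^sup>1\<close>
  satisfy \<open>D\<^sub>k Z = V\<^sub>k\<close> since \<open>Y (Z Y)\<^sup>-\<^sup>1\<close> is the inverse of \<open>Z\<close>.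
\<close>

lemma diagonal_products_factorization:
  fixes V W :: "nat \<Rightarrow> complex^'n::finite^'n"
  assumes diag: "\<And>k l i a. k < K \<Longrightarrow> l < L \<Longrightarrow> a \<noteq> i \<Longrightarrow> (V k ** W l) $ i $ a = 0"
    and edge: "\<And>k l i j. k < K \<Longrightarrow> l < L \<Longrightarrow> (i, j) \<in> G \<Longrightarrow> (V k ** W l) $ i $ i = (V k ** W l) $ j $ j"
    and nonzero: "\<And>i. \<exists>k<K. \<exists>l<L. (V k ** W l) $ i $ i \<noteq> 0"
  obtains Z :: "complex^'n^'n" and D :: "nat \<Rightarrow> 'n \<Rightarrow> complex"
  where "invertible Z"
    and "\<forall>k<K. \<forall>i a. V k $ i $ a = D k i * Z $ i $ a"
    and "\<forall>k<K. \<forall>(i, j)\<in>G. D k i = D k j"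
    and "\<forall>i. \<exists>k<K. D k i \<noteq> 0"
proof -
  define d where "d = (\<lambda>k l i. (V k ** W l) $ i $ i)"
  obtain \<kappa> where \<kappa>: "\<And>i. \<kappa> i < K" "\<And>i. \<exists>l<L. d (\<kappa> i) l i \<noteq> 0"
    using nonzero unfolding d_def by metis
  obtain s where s: "\<And>i. (\<Sum>l<L. s l * d (\<kappa> i) l i) \<noteq> 0"
    using obtain_nonvanishing_combination[of L "\<lambda>i l. d (\<kappa> i) l i"] \<kappa>(2) by auto
  define e where "e = (\<lambda>k i. \<Sum>l<L. s l * d k l i)"
  have "\<exists>k<K. e k i \<noteq> 0" for i using \<kappa>(1) s by (auto simp: e_def)
  then obtain t where t: "\<And>i. (\<Sum>k<K. t k * e k i) \<noteq> 0"
    using obtain_nonvanishing_combination[of K "\<lambda>i k. e k i"] by auto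
  define g where "g = (\<lambda>i. \<Sum>k<K. t k * e k i)"
  have g0: "g i \<noteq> 0" for i using t unfolding g_def .
  define Z :: "complex^'n^'n" where "Z = (\<Sum>k<K. cmat_scale (t k) (V k))"
  define Y :: "complex^'n^'n" where "Y = (\<Sum>l<L. cmat_scale (s l) (W l))"
  (* Q is the inverse of the diagonal matrix Z ** Y, whose diagonal is g. *)
  define Q :: "complex^'n^'n" where "Q = (\<chi> i a. if a = i then 1 / g i else 0)"
  have VY: "(V k ** Y) $ i $ a = (if a = i then e k i else 0)" if "k < K" for k i a
  proof -
    have "(V k ** Y) $ i $ a = (\<Sum>b\<in>UNIV. \<Sum>l<L. s l * (V k $ i $ b * W l $ b $ a))"
      by (simp add: matrix_matrix_mult_def Y_def cmat_scale_def sum_distrib_left mult_ac)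
    also have "\<dots> = (\<Sum>l<L. \<Sum>b\<in>UNIV. s l * (V k $ i $ b * W l $ b $ a))"
      by (rule sum.swap)
    also have "\<dots> = (\<Sum>l<L. s l * (V k ** W l) $ i $ a)"
      by (simp add: matrix_matrix_mult_def sum_distrib_left)
    also have "\<dots> = (if a = i then e k i else 0)"
      using that diag by (auto simp: e_def d_def)
    finally show ?thesis .
  qed
  have VYQ: "(V k ** Y ** Q) $ i $ a = (if a = i then e k i / g i else 0)" if "k < K" for k i a
  proof -
    have "(V k ** Y ** Q) $ i $ a = (\<Sum>b\<in>UNIV. (V k ** Y) $ i $ b * Q $ b $ a)"
      by (simp add: matrix_matrix_mult_def)
    also have "\<dots> = (\<Sum>b\<in>UNIV. if b = i then e k i * Q $ i $ a else 0)"
      using that by (intro sum.cong) (auto simp: VY)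
    also have "\<dots> = e k i * Q $ i $ a" by simp
    finally show ?thesis by (simp add: Q_def)
  qed
  have "Z ** (Y ** Q) = mat 1"
  proof -
    have "(Z ** (Y ** Q)) $ i $ a = mat 1 $ i $ a" for i a
    proof -
      have "(Z ** (Y ** Q)) $ i $ a = (\<Sum>b\<in>UNIV. \<Sum>k<K. t k * (V k $ i $ b * (Y ** Q) $ b $ a))"
        unfolding matrix_matrix_mult_def[of Z]
        by (simp add: Z_def cmat_scale_def sum_distrib_left mult_ac)
      also have "\<dots> = (\<Sum>k<K. \<Sum>b\<in>UNIV. t k * (V k $ i $ b * (Y ** Q) $ b $ a))"
        by (rule sum.swap)
      also have "\<dots> = (\<Sum>k<K. t k * (V k ** (Y ** Q)) $ i $ a)"
        unfolding matrix_matrix_mult_def[of "V _"] by (simp add: sum_distrib_left)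
      also have "\<dots> = (\<Sum>k<K. if a = i then t k * e k i / g i else 0)"
        by (intro sum.cong) (auto simp: matrix_mul_assoc VYQ)
      also have "\<dots> = (if a = i then g i / g i else 0)"
        by (simp add: g_def flip: sum_divide_distrib)
      also have "\<dots> = mat 1 $ i $ a"
        using g0 by (auto simp: mat_def)
      finally show ?thesis .
    qed
    then show ?thesis by (simp add: vec_eq_iff)
  qed
  note ZYQ = this
  have inv: "(Y ** Q) ** Z = mat 1"
    by (rule iffD1[OF matrix_left_right_inverse ZYQ])
  have Z: "invertible Z"
    unfolding invertible_def using ZYQ inv by (intro exI[of _ "Y ** Q"] conjI)
  define D where "D = (\<lambda>k i. e k i / g i)"
  have VZ: "V k $ i $ a = D k i * Z $ i $ a" if "k < K" for k i a
  proof -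
    have "V k = V k ** ((Y ** Q) ** Z)" by (simp add: inv)
    then have "V k $ i $ a = ((V k ** Y ** Q) ** Z) $ i $ a"
      by (simp add: matrix_mul_assoc)
    also have "\<dots> = (\<Sum>b\<in>UNIV. (V k ** Y ** Q) $ i $ b * Z $ b $ a)"
      by (simp add: matrix_matrix_mult_def[of "V k ** Y ** Q"])
    also have "\<dots> = (\<Sum>b\<in>UNIV. if b = i then D k i * Z $ i $ a else 0)"
      using that by (intro sum.cong) (auto simp: VYQ D_def)
    finally show ?thesis by simp
  qed
  have ed: "e k i = e k j" if "k < K" "(i, j) \<in> G" for k i j
    unfolding e_def d_def using edge[OF that(1) _ that(2)] by (intro sum.cong) auto
  have "D k i = D k j" if "k < K" "(i, j) \<in> G" for k i j
  proof -
    have "g i = g j" unfolding g_def using ed that by (intro sum.cong) auto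
    then show ?thesis using ed[OF that] by (simp add: D_def)
  qed
  moreover have "\<exists>k<K. D k i \<noteq> 0" for i
  proof -
    obtain k where "k < K" "e k i \<noteq> 0" using \<open>\<And>i. \<exists>k<K. e k i \<noteq> 0\<close> by blast
    then show ?thesis using g0[of i] by (auto simp: D_def)
  qed
  ultimately show thesis using Z VZ by (intro that[of Z D]) auto
qed

text \<open>
  Some summand of the Leibniz expansion of the determinant does not vanish.
\<close>

lemma invertible_imp_nonzero_transversal:
  fixes Z :: "complex^'n::finite^'n"
  assumes "invertible Z"
  obtains \<pi> where "bij \<pi>" and "\<And>i. Z $ i $ \<pi> i \<noteq> 0"
proof -
  have "det Z \<noteq> 0" using assms by (simp add: invertible_det_nz)
  then have "(\<Sum>p | p permutes UNIV. of_int (sign p) * (\<Prod>i\<in>UNIV. Z $ i $ p i)) \<noteq> 0"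
    by (simp add: det_def)
  then obtain p where "p permutes UNIV" "(\<Prod>i\<in>UNIV. Z $ i $ p i) \<noteq> 0"
    by (metis (no_types, lifting) mem_Collect_eq mult_zero_right sum.neutral)
  then show thesis by (intro that[of p]) (auto simp: permutes_bij)
qed

lemma sum_matrix_mult:
  fixes A :: "'x \<Rightarrow> complex^'m::finite^'n::finite"
  shows "B ** (\<Sum>x\<in>I. A x) ** C = (\<Sum>x\<in>I. B ** A x ** C)"
proof (induction I rule: infinite_finite_induct)
  case (insert x I)
  have "B ** (A x + X) ** C = B ** A x ** C + B ** X ** C" for X
    by (simp add: vec_eq_iff matrix_matrix_mult_def sum_distrib_right ring_distribs sum.distrib)
  with insert show ?case by simp
qed (simp_all add: vec_eq_iff matrix_matrix_mult_def)

section \<open>From order isomorphisms to graph isomorphisms\<close>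

text \<open>
  The left inverse \<open>\<psi>\<close> yields the factorization \<open>V\<^sub>k = D\<^sub>k Z\<close> of the Kraus matrices of \<open>\<phi>\<close>. Along
  an edge \<open>(i, j)\<close> this turns the entry of \<open>\<phi>(E\<^sub>i\<^sub>j)\<close> at \<open>(\<pi>(i), \<pi>(j))\<close> into
  \<open>(\<Sum>\<^sub>k |D\<^sub>k(i)|\<^sup>2) cnj Z\<^sub>i\<^sub>,\<^sub>\<pi>\<^sub>(\<^sub>i\<^sub>) Z\<^sub>j\<^sub>,\<^sub>\<pi>\<^sub>(\<^sub>j\<^sub>)\<close>, which is nonzero for a suitable \<open>\<pi>\<close>.
\<close>

lemma completely_positive_retract_imp_graph_embedding:
  fixes G1 G2 :: "('n::finite \<times> 'n) set" and \<phi> \<psi> :: "complex^'n^'n \<Rightarrow> complex^'n^'n"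
  assumes G1: "is_graph G1" and G2: "is_graph G2"
    and \<phi>: "completely_positive (graph_system G1) (graph_system G2) \<phi>" and \<phi>1: "\<phi> (mat 1) = mat 1"
    and \<psi>: "completely_positive (graph_system G2) (graph_system G1) \<psi>" and \<psi>1: "\<psi> (mat 1) = mat 1"
    and retract: "\<And>A. A \<in> graph_system G1 \<Longrightarrow> \<psi> (\<phi> A) = A"
  obtains \<pi> where "bij \<pi>" and "map_prod \<pi> \<pi> ` G1 \<subseteq> G2"
proof -
  obtain K :: nat and V :: "nat \<Rightarrow> complex^'n^'n"
    where V: "\<And>A. A \<in> graph_system G1 \<Longrightarrow> \<phi> A = (\<Sum>k<K. cmat_adjoint (V k) ** A ** V k)"
    by (rule completely_positive_kraus_form[OF G1 \<phi> \<phi>1]) (rule that, simp)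
  obtain L :: nat and W :: "nat \<Rightarrow> complex^'n^'n"
    where W: "\<And>A. A \<in> graph_system G2 \<Longrightarrow> \<psi> A = (\<Sum>l<L. cmat_adjoint (W l) ** A ** W l)"
    by (rule completely_positive_kraus_form[OF G2 \<psi> \<psi>1]) (rule that, simp)
  have ran: "\<phi> A \<in> graph_system G2" if "A \<in> graph_system G1" for A
    using \<phi> that by (auto simp: completely_positive_def clinear_between_def)
  define M where "M = (\<lambda>x. V (fst x) ** W (snd x))"
  define I where "I = {..<K} \<times> {..<L}"
  have I: "finite I" by (simp add: I_def)
  have fixed: "(\<Sum>x\<in>I. cmat_adjoint (M x) ** matrix_unit i j ** M x) = matrix_unit i j"
    if "(i, j) \<in> G1 \<union> Id" for i j
  proof -
    let ?A = "matrix_unit i j :: complex^'n^'n"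
    have A: "?A \<in> graph_system G1" using that by (rule matrix_unit_mem_graph_system)
    have "?A = (\<Sum>l<L. \<Sum>k<K. cmat_adjoint (W l) ** (cmat_adjoint (V k) ** ?A ** V k) ** W l)"
      using retract[OF A] W[OF ran[OF A]] by (simp add: V[OF A] sum_matrix_mult)
    also have "\<dots> = (\<Sum>l<L. \<Sum>k<K. cmat_adjoint (M (k, l)) ** ?A ** M (k, l))"
      by (simp add: M_def cmat_adjoint_mult matrix_mul_assoc)
    also have "\<dots> = (\<Sum>k<K. \<Sum>l<L. cmat_adjoint (M (k, l)) ** ?A ** M (k, l))"
      by (rule sum.swap)
    finally show ?thesis by (simp add: I_def sum.cartesian_product case_prod_beta)
  qed
  have nonzero: "\<exists>k<K. \<exists>l<L. (V k ** W l) $ i $ i \<noteq> 0" for i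
    using kraus_fixed_nonzero[of I G1 M i, OF I fixed] by (auto simp: I_def M_def)
  have diag: "(V k ** W l) $ i $ a = 0" if "k < K" "l < L" "a \<noteq> i" for k l i a
    using kraus_fixed_diagonal[of I G1 M "(k, l)" a i, OF I fixed] that by (simp add: I_def M_def)
  have edge: "(V k ** W l) $ i $ i = (V k ** W l) $ j $ j"
    if "k < K" "l < L" "(i, j) \<in> G1" for k l i j
    using kraus_fixed_edge[of I G1 M "(k, l)" i j, OF I fixed] that by (simp add: I_def M_def)
  obtain Z D where Z: "invertible Z"
    and VZ: "\<forall>k<K. \<forall>i a. V k $ i $ a = D k i * Z $ i $ a"
    and D: "\<forall>k<K. \<forall>(i, j)\<in>G1. D k i = D k j"
    and D0: "\<forall>i. \<exists>k<K. D k i \<noteq> 0"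
    by (rule diagonal_products_factorization[of K L V W G1, OF diag edge nonzero];
        (assumption | (rule that; assumption)))
  obtain \<pi> where \<pi>: "bij \<pi>" and Z\<pi>: "\<And>i. Z $ i $ \<pi> i \<noteq> 0"
    using invertible_imp_nonzero_transversal[OF Z] by blast
  have "(\<pi> i, \<pi> j) \<in> G2" if ij: "(i, j) \<in> G1" for i j
  proof -
    have A: "matrix_unit i j \<in> graph_system G1" using ij by (intro matrix_unit_mem_graph_system) auto
    have "\<phi> (matrix_unit i j) $ \<pi> i $ \<pi> j = (\<Sum>k<K. cnj (V k $ i $ \<pi> i) * V k $ j $ \<pi> j)"
      by (simp add: V[OF A] adjoint_mult_matrix_unit_nth)
    also have "\<dots> = (\<Sum>k<K. complex_of_real ((cmod (D k i))\<^sup>2) * (cnj (Z $ i $ \<pi> i) * Z $ j $ \<pi> j))"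
    proof (intro sum.cong refl)
      fix k assume "k \<in> {..<K}"
      then have "V k $ i $ \<pi> i = D k i * Z $ i $ \<pi> i" "V k $ j $ \<pi> j = D k i * Z $ j $ \<pi> j"
        using VZ D ij by force+
      then show "cnj (V k $ i $ \<pi> i) * V k $ j $ \<pi> j
          = complex_of_real ((cmod (D k i))\<^sup>2) * (cnj (Z $ i $ \<pi> i) * Z $ j $ \<pi> j)"
        by (simp add: complex_norm_square mult_ac del: of_real_power)
    qed
    also have "\<dots> = complex_of_real (\<Sum>k<K. (cmod (D k i))\<^sup>2) * (cnj (Z $ i $ \<pi> i) * Z $ j $ \<pi> j)"
      by (simp add: sum_distrib_right)
    also have "\<dots> \<noteq> 0"
    proof -
      obtain k where "k < K" "D k i \<noteq> 0" using D0 by blast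
      then have "(\<Sum>k<K. (cmod (D k i))\<^sup>2) > 0"
        by (intro sum_pos2[of _ k]) auto
      then show ?thesis
        using Z\<pi> by (simp del: of_real_sum of_real_power)
    qed
    finally have "(\<pi> i, \<pi> j) \<in> G2 \<union> Id"
      using ran[OF A] unfolding mem_graph_system_iff by blast
    moreover have "\<pi> i \<noteq> \<pi> j"
      using \<pi> ij G1 by (auto simp: bij_def inj_eq is_graph_def irrefl_def)
    ultimately show ?thesis by auto
  qed
  then have "map_prod \<pi> \<pi> ` G1 \<subseteq> G2" by auto
  with \<pi> show thesis by (rule that)
qed

text \<open>
  The embeddings of edge sets obtained from the isomorphism and from its inverse need not be inverse
  to each other, but together they force equally many edges.
\<close>

lemma order_isomorphic_imp_graph_isomorphic:
  fixes G1 G2 :: "('n::finite \<times> 'n) set"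
  assumes G1: "is_graph G1" and G2: "is_graph G2"
    and iso: "unitally_completely_order_isomorphic (graph_system G1) (graph_system G2)"
  shows "graph_isomorphic G1 G2"
proof -
  obtain \<phi> where bij: "bij_betw \<phi> (graph_system G1) (graph_system G2)"
    and \<phi>: "completely_positive (graph_system G1) (graph_system G2) \<phi>"
    and \<psi>: "completely_positive (graph_system G2) (graph_system G1) (inv_into (graph_system G1) \<phi>)"
    and \<phi>1: "\<phi> (mat 1) = mat 1"
    using iso unfolding unitally_completely_order_isomorphic_def complete_order_iso_def by blast
  let ?\<psi> = "inv_into (graph_system G1) \<phi>"
  have left: "?\<psi> (\<phi> A) = A" if "A \<in> graph_system G1" for A
    using bij that by (rule bij_betw_inv_into_left)
  have right: "\<phi> (?\<psi> B) = B" if "B \<in> graph_system G2" for B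
    using bij that by (rule bij_betw_inv_into_right)
  have "mat 1 \<in> graph_system G1" by (auto simp: mem_graph_system_iff mat_def)
  then have \<psi>1: "?\<psi> (mat 1) = mat 1" using left[of "mat 1"] by (simp add: \<phi>1)
  obtain \<pi> where \<pi>: "bij \<pi>" and G12: "map_prod \<pi> \<pi> ` G1 \<subseteq> G2"
    by (rule completely_positive_retract_imp_graph_embedding[OF G1 G2 \<phi> \<phi>1 \<psi> \<psi>1 left];
        (assumption | (rule that; assumption)))
  obtain \<rho> where \<rho>: "bij \<rho>" and G21: "map_prod \<rho> \<rho> ` G2 \<subseteq> G1"
    by (rule completely_positive_retract_imp_graph_embedding[OF G2 G1 \<psi> \<psi>1 \<phi> \<phi>1 right];
        (assumption | (rule that; assumption)))
  have inj: "inj_on (map_prod \<sigma> \<sigma>) G" if "bij \<sigma>" for \<sigma> and G :: "('n \<times> 'n) set"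
    using prod.inj_map[OF bij_is_inj bij_is_inj, OF that that] by (rule inj_on_subset) simp
  have "card G2 \<le> card G1"
    by (rule card_inj_on_le[OF inj[OF \<rho>] G21]) simp
  also have "card G1 = card (map_prod \<pi> \<pi> ` G1)"
    by (rule card_image[OF inj[OF \<pi>], symmetric])
  finally have le: "card G2 \<le> card (map_prod \<pi> \<pi> ` G1)" .
  have "map_prod \<pi> \<pi> ` G1 = G2"
    by (rule card_seteq[OF _ G12 le]) simp
  moreover have "map_prod \<pi> \<pi> ` G1 = {(\<pi> i, \<pi> j) | i j. (i, j) \<in> G1}" by force
  ultimately show ?thesis
    using \<pi> unfolding graph_isomorphic_def by (intro exI[of _ \<pi>]) simp
qed

theorem theorem3p3:
  fixes G1 G2 :: "('n::finite \<times> 'n) set"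
  assumes "is_graph G1" and "is_graph G2"
  shows "(graph_isomorphic G1 G2 \<longleftrightarrow>
            (\<exists>U :: complex^'n^'n. unitary_mat U \<and>
               {cmat_adjoint U ** A ** U | A. A \<in> graph_system G1} = graph_system G2)) \<and>
         (graph_isomorphic G1 G2 \<longleftrightarrow>
            unitally_completely_order_isomorphic (graph_system G1) (graph_system G2))"
proof -
  have sub: "cmat.subspace (graph_system G)" for G :: "('n \<times> 'n) set"
    unfolding graph_system_def by (rule cmat.subspace_span)
  let ?unitary = "\<exists>U :: complex^'n^'n. unitary_mat U \<and>
    {cmat_adjoint U ** A ** U | A. A \<in> graph_system G1} = graph_system G2"
  let ?order = "unitally_completely_order_isomorphic (graph_system G1) (graph_system G2)"
  have 12: "?unitary" if "graph_isomorphic G1 G2"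
    using that by (rule graph_isomorphic_imp_unitarily_conjugate)
  have 23: "?order" if conj: ?unitary
  proof -
    obtain U :: "complex^'n^'n" where "unitary_mat U"
      and "{cmat_adjoint U ** A ** U | A. A \<in> graph_system G1} = graph_system G2"
      using conj by (elim exE conjE) (rule that)
    then show ?thesis
      by (rule unitarily_conjugate_imp_order_isomorphic) (rule sub)+
  qed
  have 31: "graph_isomorphic G1 G2" if "?order"
    using that by (rule order_isomorphic_imp_graph_isomorphic[OF assms])
  show ?thesis
  proof (intro conjI iffI)
    show ?unitary if "graph_isomorphic G1 G2" using that by (rule 12)
    show "graph_isomorphic G1 G2" if ?unitary using that by (intro 31 23)
    show ?order if "graph_isomorphic G1 G2" using that by (intro 23 12)
    show "graph_isomorphic G1 G2" if ?order using that by (rule 31)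
  qed
qed

end
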